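(* In the setting described in the context, let $p$ be a production plan, let $P$ be the corresponding $o$-$d$ path in $D$, and let $q_P\in R$ be its resource, i.e. the sum, in the order of the path, of the resources of its arcs. Then $p$ is feasible if and only if $\rho(q_P)=0$, and the cost of $p$ is $c(q_P)$.
   Context: Production plans. $T\ge1$ is an integer, $S$ a finite set of power levels, $s^{\mathrm b}\in S$ the initial level, $\mathcal A\subset S\times S\times\{1,\dots,T\}$ a finite set of transitions $\alpha=(s^{\mathrm{init}}_\alpha,s^{\mathrm{final}}_\alpha,\tau_\alpha)$ containing $(s,s,1)$ for every $s\in S$. A production plan is a sequence $(s_1,t_1,\alpha_1),\dots,(s_k,t_k,\alpha_k)$, $k\ge1$, in $S\times\{1,\dots,T\}\times\mathcal A$ with $s^{\mathrm{init}}_{\alpha_i}=s_i$ for $1\le i\le k$; $s^{\mathrm{final}}_{\alpha_i}=s_{i+1}$ and $t_i+\tau_{\alpha_i}=t_{i+1}$ for $1\le i\le k-1$; $s_1=s^{\mathrm b}$, $t_1=1$, $t_k+\tau_{\alpha_k}=T$. Layers, modes, data. $S$ is partitioned into layers and the set of layers is partitioned into modes; $\mathsf{layer}(s)$ is the layer of $s$ and $\mathsf{mode}(s)$ the mode containing that layer. A transition $\alpha$ is a change of layer (resp. mode) if $s^{\mathrm{init}}_\alpha$ and $s^{\mathrm{final}}_\alpha$ have different layers (resp. modes). Given are minimum durations $\tau_{\mathrm{lay}},\tau_{\mathrm{mod}}\in\mathbb N$; indicator functions $\mathbf 1_{\mathsf{startup}},\mathbf 1_{\mathsf{layer}},\mathbf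 1_{\mathsf{deep}}$ on $\mathcal A$ (of startups, layer changes and deep transitions, i.e. transitions from a "high" to a "low" power level); $n^{\max}_{\mathsf{startup}},n^{\max}_{\mathsf{layer}},n^{\max}_{\mathsf{deep}}\in\mathbb N$; and a cost function $\lambda:\{1,\dots,T\}\times\mathcal A\to\mathbb R$. Feasibility. A production plan is feasible if it satisfies all of the following. (A) For any $i\in\{1,\dots,k-1\}$ such that $\alpha_i$ is a change of layer, let $\alpha_j$ be the next change of layer, i.e. $j$ is the smallest index in $\{i+1,\dots,k\}$ with $\mathsf{layer}(s^{\mathrm{final}}_{\alpha_j})\ne\mathsf{layer}(s^{\mathrm{final}}_{\alpha_i})$ (no condition if there is none); then $t_j\ge t_{i+1}+\tau_{\mathrm{lay}}$. (B) For any $i\in\{1,\dots,k-1\}$ such that $\alpha_i$ is a change of mode, let $\alpha_j$ be the next change of mode, i.e. $j$ is the smallest index in $\{i+1,\dots,k\}$ with $\mathsf{mode}(s^{\mathrm{final}}_{\alpha_j})\ne\mathsf{mode}(s^{\mathrm{final}}_{\alpha_i})$ (no condition if there is none); then $t_j\ge t_{i+1}+\tau_{\mathrm{mod}}$. (C) $\sum_{i=1}^k\mathbf 1_{\mathsf{startup}}(\alpha_i)\le n^{\max}_{\mathsf{startup}}$. (D) $\sum_{i=1}^k\mathbf 1_{\mathsf{layer}}(\alpha_i)\le n^{\max}_{\mathsf{layer}}$. (E) $\sum_{i=1}^k\mathbf 1_{\mathsf{deep}}(\alpha_i)\le n^{\max}_{\mathsf{deep}}$. The cost of the production plan is $\sum_{i=1}^k\lambda(t_i,\alpha_i)$.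 Digraph. $D=(V,A)$ has $V=(S\times\{1,\dots,T\})\cup\{o,d\}$ and arcs $\big((s,t),(s',t')\big)$ for $(s,s',t'-t)\in\mathcal A$ (corresponding to the transition $\alpha=(s,s',t'-t)$ and time step $t$), the initial arc $\big(o,(s^{\mathrm b},1)\big)$, and final arcs $\big((s,T),d\big)$, $s\in S$. An $o$-$d$ path is a path from $o$ to $d$. The path corresponding to a production plan visits successively $o,(s_1,t_1),\dots,(s_k,t_k),(s^{\mathrm{final}}_{\alpha_k},T),d$. Monoids. For $\tau\ge0$, let $\mathcal S_\tau$ be the disjoint union of $\{\mathsf{st}(a):a\in\mathbb R_+\}$, $\{\mathsf{ch}(x,y):x,y\in\mathbb R_+\}$ and $\{\mathsf{infeasible}\}$, with the associative operation: $\mathsf{st}(a)\oplus\mathsf{st}(b)=\mathsf{st}(a+b)$; $\mathsf{st}(a)\oplus\mathsf{ch}(x,y)=\mathsf{ch}(a+x,y)$; $\mathsf{ch}(x,y)\oplus\mathsf{st}(a)=\mathsf{ch}(x,y+a)$; $\mathsf{ch}(x,y)\oplus\mathsf{ch}(u,v)=\mathsf{infeasible}$ if $y+u<\tau$ and $=\mathsf{ch}(x,v)$ otherwise; $\mathsf{infeasible}\oplus q=q\oplus\mathsf{infeasible}=\mathsf{infeasible}$ for all $q$. Set $\mathcal S^{\mathrm{lay}}=\mathcal S_{\tau_{\mathrm{lay}}}$, $\mathcal S^{\mathrm{mod}}=\mathcal S_{\tau_{\mathrm{mod}}}$, and let $\rho^{\mathrm{lay}}$, $\rho^{\mathrm{mod}}$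 be the $\{0,1\}$-valued functions on them equal to $1$ at $\mathsf{infeasible}$ and $0$ elsewhere. Let $R=\mathcal S^{\mathrm{lay}}\times\mathcal S^{\mathrm{mod}}\times\mathbb Z_+^3\times\mathbb R$ with componentwise sum (usual addition on $\mathbb Z_+$ and $\mathbb R$). Arc resources. The resource of an arc is $(q^{\mathrm{lay}},q^{\mathrm{mod}},n^{\mathrm s},n^{\mathrm l},n^{\mathrm d},\tilde c)\in R$. For an arc corresponding to a transition $\alpha$ and time step $t$: $q^{\mathrm{lay}}=\mathsf{ch}(0,0)$ if $\alpha$ is a change of layer and $\mathsf{st}(\tau_\alpha)$ otherwise; $q^{\mathrm{mod}}=\mathsf{ch}(0,0)$ if $\alpha$ is a change of mode and $\mathsf{st}(\tau_\alpha)$ otherwise; $n^{\mathrm s}=\mathbf 1_{\mathsf{startup}}(\alpha)$, $n^{\mathrm l}=\mathbf 1_{\mathsf{layer}}(\alpha)$, $n^{\mathrm d}=\mathbf 1_{\mathsf{deep}}(\alpha)$, $\tilde c=\lambda(t,\alpha)$. For the initial arc: $q^{\mathrm{lay}}=\mathsf{ch}(0,\tau_{\mathrm{lay}}-\tau_{\mathrm{init}})$, where $\tau_{\mathrm{init}}$ is the duration after which the unit is allowed to leave the layer of its initial level, and $q^{\mathrm{mod}}=\mathsf{ch}(0,0)$. For final arcs: $q^{\mathrm{lay}}=\mathsf{st}(0)$ and $q^{\mathrm{mod}}=\mathsf{ch}(0,0)$. For the initial and final arcs $n^{\mathrm s}=n^{\mathrm l}=n^{\mathrm d}=\tilde c=0$.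 Functions. With $\mathbf 1_I$ the indicator function of an interval $I$, $\rho:R\to\mathbb R$ and $c:R\to\mathbb R$ are defined by $$\rho(q^{\mathrm{lay}},q^{\mathrm{mod}},n^{\mathrm s},n^{\mathrm l},n^{\mathrm d},\tilde c)=\max\big(\rho^{\mathrm{lay}}(q^{\mathrm{lay}}),\rho^{\mathrm{mod}}(q^{\mathrm{mod}}),\mathbf 1_{(n^{\max}_{\mathsf{startup}},\infty)}(n^{\mathrm s}),\mathbf 1_{(n^{\max}_{\mathsf{layer}},\infty)}(n^{\mathrm l}),\mathbf 1_{(n^{\max}_{\mathsf{deep}},\infty)}(n^{\mathrm d})\big)$$ and $c(q^{\mathrm{lay}},q^{\mathrm{mod}},n^{\mathrm s},n^{\mathrm l},n^{\mathrm d},\tilde c)=\tilde c$.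
   Formalization: As stated the equivalence fails; "p is feasible" is replaced by "p is feasible and changes no layer before 1+τ_init, every mode change starts at or after 1+τ_mod and ends by T−τ_mod, and 1+τ_mod ≤ T", the conditions the initial and final arcs impose; 0≤τ_init≤τ_lay is assumed. *)

theory Defs
  imports "HOL-Algebra.Group" "HOL-Library.Disjoint_Sets" "HOL-Library.Indicator_Function"
    "Graph_Theory.Graph_Theory"
begin

section \<open>Transitions and production plans\<close>

text \<open>A transition is a triple (initial level, final level, duration).\<close>

type_synonym 'a transition = "'a \<times> 'a \<times> nat"

definition s_init :: "'a transition \<Rightarrow> 'a" where
  "s_init \<alpha> = fst \<alpha>"

definition s_final :: "'a transition \<Rightarrow> 'a" where
  "s_final \<alpha> = fst (snd \<alpha>)"

definition duration :: "'a transition \<Rightarrow> nat" where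
  "duration \<alpha> = snd (snd \<alpha>)"

text \<open>
  The three indicator functions on transitions are given by the sets \<open>startups\<close>,
  \<open>layer_count_set\<close> and \<open>deeps\<close> they indicate. These sets are arbitrary; in particular
  \<open>layer_count_set\<close> may be, but need not be, the set of all changes of layer.
\<close>

record 'a unit_data =
  horizon :: nat
  levels :: "'a set"
  init_level :: 'a
  transitions :: "'a transition set"
  layers :: "'a set set"
  modes :: "'a set set set"
  tau_lay :: nat
  tau_mod :: nat
  tau_init :: real
  startups :: "'a transition set"
  layer_count_set :: "'a transition set"
  deeps :: "'a transition set"
  max_startups :: nat
  max_layer_changes :: nat
  max_deeps :: nat
  gen_cost :: "nat \<Rightarrow> 'a transition \<Rightarrow> real"

text \<open>
  The inequality \<open>tau_init U \<le> tau_lay U\<close> is what makes the resource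
  \<open>Ch 0 (tau_lay U - tau_init U)\<close> of the initial arc an element of the layer monoid.
\<close>

definition valid_unit :: "'a unit_data \<Rightarrow> bool" where
  "valid_unit U \<longleftrightarrow>
     1 \<le> horizon U \<and>
     finite (levels U) \<and>
     init_level U \<in> levels U \<and>
     transitions U \<subseteq> levels U \<times> levels U \<times> {1..horizon U} \<and>
     (\<forall>s \<in> levels U. (s, s, 1) \<in> transitions U) \<and>
     partition_on (levels U) (layers U) \<and>
     partition_on (layers U) (modes U) \<and>
     0 \<le> tau_init U \<and> tau_init U \<le> real (tau_lay U) \<and>
     startups U \<subseteq> transitions U \<and>
     layer_count_set U \<subseteq> transitions U \<and>
     deeps U \<subseteq> transitions U"

definition layer :: "'a unit_data \<Rightarrow> 'a \<Rightarrow> 'a set" where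
  "layer U s = (THE L. L \<in> layers U \<and> s \<in> L)"

definition mode :: "'a unit_data \<Rightarrow> 'a \<Rightarrow> 'a set set" where
  "mode U s = (THE M. M \<in> modes U \<and> layer U s \<in> M)"

definition layer_change :: "'a unit_data \<Rightarrow> 'a transition \<Rightarrow> bool" where
  "layer_change U \<alpha> \<longleftrightarrow> layer U (s_init \<alpha>) \<noteq> layer U (s_final \<alpha>)"

definition mode_change :: "'a unit_data \<Rightarrow> 'a transition \<Rightarrow> bool" where
  "mode_change U \<alpha> \<longleftrightarrow> mode U (s_init \<alpha>) \<noteq> mode U (s_final \<alpha>)"

text \<open>
  A plan is a list of triples (level, time step, transition). Positions are counted from 0,
  so that the first and last triples are at positions 0 and \<open>length p - 1\<close>.
\<close>

type_synonym 'a plan = "('a \<times> nat \<times> 'a transition) list"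

definition level_at :: "'a plan \<Rightarrow> nat \<Rightarrow> 'a" where
  "level_at p i = fst (p ! i)"

definition time_at :: "'a plan \<Rightarrow> nat \<Rightarrow> nat" where
  "time_at p i = fst (snd (p ! i))"

definition trans_at :: "'a plan \<Rightarrow> nat \<Rightarrow> 'a transition" where
  "trans_at p i = snd (snd (p ! i))"

definition production_plan :: "'a unit_data \<Rightarrow> 'a plan \<Rightarrow> bool" where
  "production_plan U p \<longleftrightarrow>
     p \<noteq> [] \<and>
     set p \<subseteq> levels U \<times> {1..horizon U} \<times> transitions U \<and>
     (\<forall>i < length p. s_init (trans_at p i) = level_at p i) \<and>
     (\<forall>i. Suc i < length p \<longrightarrow>
        s_final (trans_at p i) = level_at p (Suc i) \<and>
        time_at p i + duration (trans_at p i) = time_at p (Suc i)) \<and>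
     level_at p 0 = init_level U \<and>
     time_at p 0 = 1 \<and>
     time_at p (length p - 1) + duration (trans_at p (length p - 1)) = horizon U"

section \<open>Feasibility and cost\<close>

text \<open>
  \<open>next_change f p i j\<close>: \<open>j\<close> is the smallest position after \<open>i\<close> whose transition ends in
  another class (layer or mode, according to \<open>f\<close>) than the transition at position \<open>i\<close>.
\<close>

definition next_change :: "('a \<Rightarrow> 'b) \<Rightarrow> 'a plan \<Rightarrow> nat \<Rightarrow> nat \<Rightarrow> bool" where
  "next_change f p i j \<longleftrightarrow>
     i < j \<and> j < length p \<and>
     f (s_final (trans_at p j)) \<noteq> f (s_final (trans_at p i)) \<and>
     (\<forall>m. i < m \<and> m < j \<longrightarrow> f (s_final (trans_at p m)) = f (s_final (trans_at p i)))"

definition feasible :: "'a unit_data \<Rightarrow> 'a plan \<Rightarrow> bool" where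
  "feasible U p \<longleftrightarrow>
     (\<forall>i j. Suc i < length p \<and> layer_change U (trans_at p i) \<and> next_change (layer U) p i j \<longrightarrow>
        time_at p (Suc i) + tau_lay U \<le> time_at p j) \<and>
     (\<forall>i j. Suc i < length p \<and> mode_change U (trans_at p i) \<and> next_change (mode U) p i j \<longrightarrow>
        time_at p (Suc i) + tau_mod U \<le> time_at p j) \<and>
     (\<Sum>i < length p. indicator (startups U) (trans_at p i)) \<le> max_startups U \<and>
     (\<Sum>i < length p. indicator (layer_count_set U) (trans_at p i)) \<le> max_layer_changes U \<and>
     (\<Sum>i < length p. indicator (deeps U) (trans_at p i)) \<le> max_deeps U"

definition cost :: "'a unit_data \<Rightarrow> 'a plan \<Rightarrow> real" where
  "cost U p = (\<Sum>i < length p. gen_cost U (time_at p i) (trans_at p i))"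

text \<open>
  The duration requirements that the resources of the initial and final arcs impose at the two
  ends of the horizon, and that are not part of \<open>feasible\<close>. The initial arc carries
  \<open>Ch 0 (tau_lay U - tau_init U)\<close> for layers, so the unit stays in its initial layer for at
  least \<open>tau_init U\<close>. Both arcs carry \<open>Ch 0 0\<close> for modes, so the start and the end of the
  horizon count as changes of mode: the unit stays for at least \<open>tau_mod U\<close> in its first mode and
  in its last one, and \<open>horizon U - 1\<close> is at least \<open>tau_mod U\<close> if it never changes mode.
\<close>

definition boundary_conditions :: "'a unit_data \<Rightarrow> 'a plan \<Rightarrow> bool" where
  "boundary_conditions U p \<longleftrightarrow>
     (\<forall>i < length p. layer_change U (trans_at p i) \<longrightarrow> 1 + tau_init U \<le> real (time_at p i)) \<and>
     (\<forall>i < length p. mode_change U (trans_at p i) \<longrightarrow>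
        1 + tau_mod U \<le> time_at p i \<and>
        time_at p i + duration (trans_at p i) + tau_mod U \<le> horizon U) \<and>
     1 + tau_mod U \<le> horizon U"

section \<open>Digraph\<close>

datatype 'a node = Origin | Destination | State 'a nat

definition plan_digraph :: "'a unit_data \<Rightarrow> 'a node pair_pre_digraph" where
  "plan_digraph U = \<lparr>
     pverts = {State s t |s t. s \<in> levels U \<and> t \<in> {1..horizon U}} \<union> {Origin, Destination},
     parcs =
       {(State s t, State s' (t + \<tau>)) |s s' t \<tau>.
          (s, s', \<tau>) \<in> transitions U \<and> 1 \<le> t \<and> t + \<tau> \<le> horizon U} \<union>
       {(Origin, State (init_level U) 1)} \<union>
       {(State s (horizon U), Destination) |s. s \<in> levels U} \<rparr>"

definition plan_nodes :: "'a unit_data \<Rightarrow> 'a plan \<Rightarrow> 'a node list" where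
  "plan_nodes U p =
     Origin # map (\<lambda>(s, t, \<alpha>). State s t) p @
     [State (s_final (trans_at p (length p - 1))) (horizon U), Destination]"

definition corresponding_path ::
  "'a unit_data \<Rightarrow> 'a plan \<Rightarrow> ('a node \<times> 'a node) list \<Rightarrow> bool" where
  "corresponding_path U p P \<longleftrightarrow>
     pre_digraph.apath (with_proj (plan_digraph U)) Origin P Destination \<and>
     pre_digraph.awalk_verts (with_proj (plan_digraph U)) Origin P = plan_nodes U p"

section \<open>Resources\<close>

datatype dur_res = St real | Ch real real | Infeasible

fun dur_add :: "real \<Rightarrow> dur_res \<Rightarrow> dur_res \<Rightarrow> dur_res" where
  "dur_add \<tau> (St a) (St b) = St (a + b)"
| "dur_add \<tau> (St a) (Ch x y) = Ch (a + x) y"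
| "dur_add \<tau> (Ch x y) (St a) = Ch x (y + a)"
| "dur_add \<tau> (Ch x y) (Ch u v) = (if y + u < \<tau> then Infeasible else Ch x v)"
| "dur_add \<tau> Infeasible q = Infeasible"
| "dur_add \<tau> q Infeasible = Infeasible"

definition dur_monoid :: "real \<Rightarrow> dur_res monoid" where
  "dur_monoid \<tau> = \<lparr>
     carrier = {St a |a. 0 \<le> a} \<union> {Ch x y |x y. 0 \<le> x \<and> 0 \<le> y} \<union> {Infeasible},
     monoid.mult = dur_add \<tau>,
     one = St 0 \<rparr>"

definition additive_monoid :: "'b::monoid_add monoid" where
  "additive_monoid = \<lparr> carrier = UNIV, monoid.mult = (+), one = 0 \<rparr>"

type_synonym resource = "dur_res \<times> dur_res \<times> nat \<times> nat \<times> nat \<times> real"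

definition resource_monoid :: "'a unit_data \<Rightarrow> resource monoid" where
  "resource_monoid U =
     dur_monoid (tau_lay U) \<times>\<times> (dur_monoid (tau_mod U) \<times>\<times>
       (additive_monoid \<times>\<times> (additive_monoid \<times>\<times> (additive_monoid \<times>\<times> additive_monoid))))"

definition transition_resource :: "'a unit_data \<Rightarrow> nat \<Rightarrow> 'a transition \<Rightarrow> resource" where
  "transition_resource U t \<alpha> =
     (if layer_change U \<alpha> then Ch 0 0 else St (duration \<alpha>),
      if mode_change U \<alpha> then Ch 0 0 else St (duration \<alpha>),
      indicator (startups U) \<alpha>,
      indicator (layer_count_set U) \<alpha>,
      indicator (deeps U) \<alpha>,
      gen_cost U t \<alpha>)"

text \<open>Only the values on arcs of \<open>plan_digraph U\<close> matter.\<close>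

fun arc_resource :: "'a unit_data \<Rightarrow> 'a node \<times> 'a node \<Rightarrow> resource" where
  "arc_resource U (State s t, State s' t') = transition_resource U t (s, s', t' - t)"
| "arc_resource U (Origin, v) = (Ch 0 (tau_lay U - tau_init U), Ch 0 0, 0, 0, 0, 0)"
| "arc_resource U (v, Destination) = (St 0, Ch 0 0, 0, 0, 0, 0)"

definition path_resource :: "'a unit_data \<Rightarrow> ('a node \<times> 'a node) list \<Rightarrow> resource" where
  "path_resource U P =
     foldr (monoid.mult (resource_monoid U)) (map (arc_resource U) P) \<one>\<^bsub>resource_monoid U\<^esub>"

fun rho :: "'a unit_data \<Rightarrow> resource \<Rightarrow> real" where
  "rho U (ql, qm, ns, nl, nd, c) =
     Max {indicator {Infeasible} ql,
          indicator {Infeasible} qm,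
          indicator {real (max_startups U)<..} (real ns),
          indicator {real (max_layer_changes U)<..} (real nl),
          indicator {real (max_deeps U)<..} (real nd)}"

fun res_cost :: "resource \<Rightarrow> real" where
  "res_cost (ql, qm, ns, nl, nd, c) = c"

section \<open>Well-definedness\<close>

lemma dur_add_assoc: "dur_add \<tau> (dur_add \<tau> a b) c = dur_add \<tau> a (dur_add \<tau> b c)"
  by (cases a; cases b; cases c) (auto simp: add.assoc)

lemma monoid_dur_monoid: "monoid (dur_monoid \<tau>)"
proof (rule monoidI)
  fix x y assume "x \<in> carrier (dur_monoid \<tau>)" "y \<in> carrier (dur_monoid \<tau>)"
  then show "x \<otimes>\<^bsub>dur_monoid \<tau>\<^esub> y \<in> carrier (dur_monoid \<tau>)"
    by (cases x; cases y) (auto simp: dur_monoid_def)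
next
  fix x show "\<one>\<^bsub>dur_monoid \<tau>\<^esub> \<otimes>\<^bsub>dur_monoid \<tau>\<^esub> x = x"
    by (cases x) (auto simp: dur_monoid_def)
next
  fix x show "x \<otimes>\<^bsub>dur_monoid \<tau>\<^esub> \<one>\<^bsub>dur_monoid \<tau>\<^esub> = x"
    by (cases x) (auto simp: dur_monoid_def)
qed (auto simp: dur_monoid_def dur_add_assoc)

lemma monoid_additive_monoid: "monoid additive_monoid"
  by (rule monoidI) (auto simp: additive_monoid_def add.assoc)

lemma monoid_resource_monoid: "monoid (resource_monoid U)"
  unfolding resource_monoid_def
  by (intro DirProd_monoid monoid_dur_monoid monoid_additive_monoid)

lemma arc_resource_closed:
  assumes "valid_unit U" "a \<in> parcs (plan_digraph U)"
  shows "arc_resource U a \<in> carrier (resource_monoid U)"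
  using assms
  by (auto simp: plan_digraph_def valid_unit_def resource_monoid_def dur_monoid_def
      additive_monoid_def transition_resource_def)

lemma path_resource_closed:
  assumes "valid_unit U" "corresponding_path U p P"
  shows "path_resource U P \<in> carrier (resource_monoid U)"
proof -
  interpret monoid "resource_monoid U" by (rule monoid_resource_monoid)
  have "set P \<subseteq> parcs (plan_digraph U)"
    using assms(2) by (simp add: corresponding_path_def pre_digraph.apath_def pre_digraph.awalk_def)
  then show ?thesis
    unfolding path_resource_def
    by (induction P) (auto simp: arc_resource_closed[OF assms(1)])
qed

lemma pawalk_zip:
  "pawalk_verts u (zip (u # ns) ns) = u # ns" "pcas u (zip (u # ns) ns) (last (u # ns))"
  by (induction ns arbitrary: u) auto

lemma corresponding_path_exists:
  assumes U: "valid_unit U" and p: "production_plan U p"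
  shows "\<exists>P. corresponding_path U p P"
proof -
  define k where "k = length p"
  define sf where "sf = s_final (trans_at p (k - 1))"
  define ns where
    "ns = map (\<lambda>(s, t, \<alpha>). State s t) p @ [State sf (horizon U), Destination]"
  define P where "P = zip (Origin # ns) ns"
  have ns: "plan_nodes U p = Origin # ns"
    by (simp add: plan_nodes_def ns_def sf_def k_def)
  have k: "k > 0" using p by (simp add: k_def production_plan_def)
  have mem: "level_at p i \<in> levels U \<and> 1 \<le> time_at p i \<and> time_at p i \<le> horizon U \<and>
             trans_at p i \<in> transitions U" if "i < k" for i
  proof -
    have "p ! i \<in> levels U \<times> {1..horizon U} \<times> transitions U"
      using p that nth_mem[of i p] unfolding production_plan_def k_def by blast
    then show ?thesis by (auto simp: level_at_def time_at_def trans_at_def)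
  qed
  have tr: "s_init (trans_at p i) = level_at p i" if "i < k" for i
    using p that by (simp add: production_plan_def k_def)
  have step: "s_final (trans_at p i) = level_at p (Suc i)"
             "time_at p i + duration (trans_at p i) = time_at p (Suc i)" if "Suc i < k" for i
    using p that by (simp_all add: production_plan_def k_def)
  have first: "level_at p 0 = init_level U" "time_at p 0 = 1"
    and final: "time_at p (k - 1) + duration (trans_at p (k - 1)) = horizon U"
    using p by (simp_all add: production_plan_def k_def)
  have dur: "1 \<le> duration (trans_at p i)" and fin: "s_final (trans_at p i) \<in> levels U"
    if "i < k" for i
    using U mem[OF that] by (auto simp: valid_unit_def duration_def s_final_def)
  have len: "length ns = k + 2" by (simp add: ns_def k_def)
  have nth1: "ns ! i = State (level_at p i) (time_at p i)" if "i < k" for i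
    using that by (simp add: ns_def k_def nth_append level_at_def time_at_def split: prod.splits)
  have nthk: "ns ! k = State sf (horizon U)" "ns ! Suc k = Destination"
    by (simp_all add: ns_def k_def nth_append)
  define tm where "tm i = (if i < k then time_at p i else horizon U)" for i
  have tm_step: "tm i < tm (Suc i)" if "i < k" for i
  proof (cases "Suc i < k")
    case True
    then show ?thesis using step(2)[OF True] dur[of i] by (simp add: tm_def)
  next
    case False
    then have "i = k - 1" using that by simp
    then show ?thesis using final dur[of i] that by (simp add: tm_def)
  qed
  have tm_mono: "tm i < tm j" if "i < j" "j \<le> k" for i j
    using that
  proof (induction j)
    case (Suc j)
    then show ?case using tm_step[of j] by (cases "i = j") auto
  qed simp
  have nth_state: "\<exists>s. ns ! i = State s (tm i)" if "i \<le> k" for i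
    using that nth1[of i] nthk by (cases "i < k") (auto simp: tm_def)
  have dist_aux: "ns ! i \<noteq> ns ! j" if "i < j" "j < k + 2" for i j
  proof (cases "j = Suc k")
    case True
    then show ?thesis using that nth_state[of i] nthk by auto
  next
    case False
    then show ?thesis using that nth_state[of i] nth_state[of j] tm_mono[of i j] by auto
  qed
  have dist: "distinct ns"
    unfolding distinct_conv_nth len using dist_aux by (metis nat_neq_iff)
  have "Origin \<notin> set ns" by (auto simp: ns_def)
  with dist have dist: "distinct (Origin # ns)" by simp
  have arcs: "set P \<subseteq> parcs (plan_digraph U)"
  proof
    fix a assume "a \<in> set P"
    then obtain i where i: "i < k + 2" "a = ((Origin # ns) ! i, ns ! i)"
      by (auto simp: P_def set_zip len)
    consider "i = 0" | m where "i = Suc m" "Suc m < k" | m where "i = Suc m" "Suc m = k"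
      | "i = Suc k"
      using i(1) by (cases i) (auto, metis Suc_lessI less_antisym)
    then show "a \<in> parcs (plan_digraph U)"
    proof cases
      case 1
      then show ?thesis using i k nth1[of 0] first by (simp add: plan_digraph_def)
    next
      case (2 m)
      let ?\<alpha> = "trans_at p m"
      have "?\<alpha> = (level_at p m, level_at p (Suc m), duration ?\<alpha>)"
        using tr[of m] step[of m] 2 by (auto simp: s_init_def s_final_def duration_def prod_eq_iff)
      moreover have "?\<alpha> \<in> transitions U" using mem[of m] 2 by simp
      moreover have "a = (State (level_at p m) (time_at p m),
          State (level_at p (Suc m)) (time_at p m + duration ?\<alpha>))"
        using i 2 nth1[of m] nth1[of "Suc m"] step[of m] by simp
      moreover have "1 \<le> time_at p m" "time_at p m + duration ?\<alpha> \<le> horizon U"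
        using mem[of m] mem[of "Suc m"] step[of m] 2 by simp_all
      ultimately show ?thesis unfolding plan_digraph_def by fastforce
    next
      case (3 m)
      let ?\<alpha> = "trans_at p m"
      have m: "m = k - 1" using 3 by simp
      have "?\<alpha> = (level_at p m, sf, duration ?\<alpha>)"
        using tr[of m] 3 m by (auto simp: sf_def s_init_def s_final_def duration_def prod_eq_iff)
      moreover have "?\<alpha> \<in> transitions U" using mem[of m] 3 by simp
      moreover have "a = (State (level_at p m) (time_at p m),
          State sf (time_at p m + duration ?\<alpha>))"
        using i 3 m nth1[of m] nthk final by simp
      moreover have "1 \<le> time_at p m" "time_at p m + duration ?\<alpha> \<le> horizon U"
        using mem[of m] final 3 m by simp_all
      ultimately show ?thesis unfolding plan_digraph_def by fastforce
    next
      case 4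
      then show ?thesis
        using i nthk fin[of "k - 1"] k by (simp add: plan_digraph_def sf_def)
    qed
  qed
  have "last (Origin # ns) = Destination" by (simp add: ns_def)
  then have "corresponding_path U p P"
    using pawalk_zip[of Origin ns] arcs dist
    by (simp add: corresponding_path_def pre_digraph.apath_def pre_digraph.awalk_def
        cas_with_proj_eq awalk_verts_with_proj_eq ns P_def plan_digraph_def)
  then show ?thesis by blast
qed

end

theory Submission
  imports Defs
begin

text \<open>
  In the monoid \<open>\<S>\<^sub>\<tau>\<close> a product of resources is \<open>Infeasible\<close> exactly when two consecutive factors
  of the form \<open>Ch\<close> are separated by a total duration below \<open>\<tau>\<close>. Along the path of a plan, the
  duration between consecutive changes is the difference of their time steps, so the inner pairs of
  changes yield conditions (A) and (B), and the pairs that involve the initial or the final arc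
  yield the boundary conditions. The other components are ordinary sums.
\<close>

section \<open>Products of duration resources\<close>

text \<open>A relation rather than a \<open>LEAST\<close> term, so that the absence of a later
  marked index needs no default value.\<close>

definition next_after :: "(nat \<Rightarrow> bool) \<Rightarrow> nat \<Rightarrow> nat \<Rightarrow> bool" where
  "next_after c n j \<longleftrightarrow> n \<le> j \<and> c j \<and> (\<forall>m. n \<le> m \<and> m < j \<longrightarrow> \<not> c m)"

lemma next_after_unique: "next_after c n i \<Longrightarrow> next_after c n j \<Longrightarrow> i = j"
  unfolding next_after_def by (metis nat_neq_iff)

lemma next_after_exists:
  assumes "c k" "n \<le> k"
  obtains j where "next_after c n j" "j \<le> k"
proof -
  define j where "j = (LEAST j. n \<le> j \<and> c j)"
  have "n \<le> j \<and> c j" unfolding j_def by (rule LeastI[of _ k]) (simp add: assms)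
  moreover have "j \<le> k" unfolding j_def by (rule Least_le) (simp add: assms)
  moreover have "\<not> (n \<le> m \<and> c m)" if "m < j" for m
    using that unfolding j_def by (rule not_less_Least)
  ultimately show ?thesis using that[of j] by (simp add: next_after_def)
qed

lemma next_after_Suc: "\<not> c n \<Longrightarrow> next_after c n j \<longleftrightarrow> next_after c (Suc n) j"
  unfolding next_after_def by (metis Suc_leD Suc_leI le_neq_implies_less)

text \<open>The gap is measured from \<open>t (Suc i)\<close>, the end of step \<open>i\<close>: the
  factor \<open>Ch 0 0\<close> of a change carries none of its own duration.\<close>

definition too_close ::
  "real \<Rightarrow> (nat \<Rightarrow> bool) \<Rightarrow> (nat \<Rightarrow> nat) \<Rightarrow> nat \<Rightarrow> nat \<Rightarrow> bool" where
  "too_close \<tau> c t K n \<longleftrightarrow>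
     (\<exists>i j. n \<le> i \<and> j < K \<and> c i \<and> next_after c (Suc i) j \<and> real (t j) < real (t (Suc i)) + \<tau>)"

text \<open>Peels off index \<open>n\<close> for the descending induction: the only new pairs are
  those whose first index is \<open>n\<close>.\<close>

lemma too_close_step:
  "too_close \<tau> c t K n \<longleftrightarrow> too_close \<tau> c t K (Suc n) \<or>
     (c n \<and> (\<exists>j<K. next_after c (Suc n) j \<and> real (t j) < real (t (Suc n)) + \<tau>))"
proof -
  have "n \<le> i \<longleftrightarrow> i = n \<or> Suc n \<le> i" for i by auto
  then show ?thesis unfolding too_close_def by (simp only: conj_disj_distribR ex_disj_distrib) auto
qed

definition dur_item :: "(nat \<Rightarrow> bool) \<Rightarrow> (nat \<Rightarrow> nat) \<Rightarrow> nat \<Rightarrow> dur_res" where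
  "dur_item c d i = (if c i then Ch 0 0 else St (d i))"

text \<open>Invariant for extending a suffix to the left: \<open>x\<close> is the time from the
  start of the suffix to its first change. Nothing is recorded about \<open>a\<close> and
  \<open>y\<close>, since prepending a factor never compares them with \<tau>.\<close>

lemma dur_product_suffix:
  fixes \<tau> :: real and c :: "nat \<Rightarrow> bool" and t d :: "nat \<Rightarrow> nat"
  assumes t: "\<And>i. i < K \<Longrightarrow> t (Suc i) = t i + d i" and "n \<le> K"
  defines "F \<equiv> \<lambda>n. foldr (dur_add \<tau>) (map (dur_item c d) [n..<K]) (St 0)"
  shows "case F n of
      St a \<Rightarrow> (\<forall>j. n \<le> j \<and> j < K \<longrightarrow> \<not> c j) \<and> \<not> too_close \<tau> c t K n
    | Ch x y \<Rightarrow> (\<exists>j<K. next_after c n j \<and> x = real (t j) - real (t n)) \<and> \<not> too_close \<tau> c t K n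
    | Infeasible \<Rightarrow> too_close \<tau> c t K n"
  using \<open>n \<le> K\<close>
proof (induction n rule: inc_induct)
  case base
  have "\<not> too_close \<tau> c t K K" unfolding too_close_def next_after_def by auto
  then show ?case by (auto simp: F_def)
next
  case (step n)
  have F: "F n = dur_add \<tau> (dur_item c d n) (F (Suc n))"
    using step.hyps by (simp add: F_def upt_conv_Cons)
  note tn = t[OF step.hyps(2)]
  show ?case
  proof (cases "F (Suc n)")
    case (St a)
    then have none: "\<forall>j. Suc n \<le> j \<and> j < K \<longrightarrow> \<not> c j" and "\<not> too_close \<tau> c t K (Suc n)"
      using step.IH by auto
    then have close: "\<not> too_close \<tau> c t K n"
      using too_close_step[of \<tau> c t K n] unfolding next_after_def by auto
    show ?thesis
    proof (cases "c n")
      case True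
      then have "next_after c n n" by (auto simp: next_after_def)
      then show ?thesis using True St F close step.hyps by (auto simp: dur_item_def)
    next
      case False
      then have "\<forall>j. n \<le> j \<and> j < K \<longrightarrow> \<not> c j"
        using none by (metis Suc_leI le_neq_implies_less)
      then show ?thesis using False St F close by (simp add: dur_item_def)
    qed
  next
    case (Ch x y)
    then obtain j where j: "j < K" "next_after c (Suc n) j" "x = real (t j) - real (t (Suc n))"
      and close: "\<not> too_close \<tau> c t K (Suc n)"
      using step.IH by auto
    show ?thesis
    proof (cases "c n")
      case True
      then have nn: "next_after c n n" by (auto simp: next_after_def)
      \<comment> \<open>The only possible new pair is \<open>n\<close> with the first change
        \<open>j\<close> of the suffix. Its gap is \<open>x\<close>, and \<open>dur_add\<close>
        tests exactly \<open>0 + x < \<tau>\<close>.\<close>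
      have "too_close \<tau> c t K n \<longleftrightarrow> x < \<tau>"
      proof
        assume "too_close \<tau> c t K n"
        then obtain i where "next_after c (Suc n) i" "real (t i) < real (t (Suc n)) + \<tau>"
          using close too_close_step[of \<tau> c t K n] by metis
        then show "x < \<tau>" using next_after_unique[OF j(2)] j(3) by auto
      next
        assume "x < \<tau>"
        then have "real (t j) < real (t (Suc n)) + \<tau>" using j(3) by simp
        then show "too_close \<tau> c t K n"
          using j(1,2) True too_close_step[of \<tau> c t K n] by metis
      qed
      then show ?thesis using True Ch F nn step.hyps by (auto simp: dur_item_def)
    next
      case False
      have "\<not> too_close \<tau> c t K n"
        using close False too_close_step[of \<tau> c t K n] by blast
      \<comment> \<open>The first change stays \<open>j\<close>; the distance to it grows by
        \<open>d n\<close>, which is \<open>t (Suc n) - t n\<close>.\<close>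
      then show ?thesis using False Ch F j tn next_after_Suc[of c n j]
        by (auto simp: dur_item_def intro!: exI[of _ j])
    qed
  next
    case Infeasible
    then have "too_close \<tau> c t K n" using step.IH too_close_step[of \<tau> c t K n] by simp
    then show ?thesis using Infeasible F by (auto simp: dur_item_def)
  qed
qed

text \<open>The factor \<open>Ch 0 b\<close> acts as a change before \<open>t 0\<close> since which
  an amount \<open>b\<close> has already elapsed. It adds one test, against the first change of the
  list.\<close>

lemma dur_product_feasible_iff:
  assumes t: "\<And>i. i < K \<Longrightarrow> t (Suc i) = t i + d i"
  shows "dur_add \<tau> (Ch 0 b) (foldr (dur_add \<tau>) (map (dur_item c d) [0..<K]) (St 0)) \<noteq> Infeasible
    \<longleftrightarrow> (\<forall>i j. j < K \<and> c i \<and> next_after c (Suc i) j \<longrightarrow> real (t (Suc i)) + \<tau> \<le> real (t j)) \<and>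
      (\<forall>j<K. c j \<longrightarrow> real (t 0) + \<tau> \<le> b + real (t j))"
    (is "dur_add \<tau> _ ?F \<noteq> _ \<longleftrightarrow> ?A \<and> ?B")
proof -
  have A: "?A \<longleftrightarrow> \<not> too_close \<tau> c t K 0"
    unfolding too_close_def by (simp add: not_less) (meson not_less)
  note suffix = dur_product_suffix[where t = t and d = d and K = K and n = 0 and c = c and \<tau> = \<tau>,
      OF t le0, simplified]
  show ?thesis
  proof (cases ?F)
    case (St a)
    then show ?thesis using suffix A by auto
  next
    case (Ch x y)
    then obtain j where j: "j < K" "next_after c 0 j" "x = real (t j) - real (t 0)"
      and close: "\<not> too_close \<tau> c t K 0"
      using suffix by auto
    \<comment> \<open>Times increase weakly with the index, so the bound for the first change
      implies the bound for every change.\<close>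
    have "t j \<le> t i" if "i < K" "c i" for i
    proof -
      have "j \<le> i" using j(2) that unfolding next_after_def by (metis le0 not_less)
      then show ?thesis using \<open>i < K\<close>
        by (induction i rule: dec_induct) (auto simp: t)
    qed
    then have "?B \<longleftrightarrow> real (t 0) + \<tau> \<le> b + real (t j)"
      using j unfolding next_after_def by fastforce
    then show ?thesis using Ch j close A by auto
  next
    case Infeasible
    then show ?thesis using suffix A by auto
  qed
qed

section \<open>The resource of the path of a plan\<close>

lemma resource_product_components:
  "foldr (monoid.mult (resource_monoid U)) rs \<one>\<^bsub>resource_monoid U\<^esub> =
    (foldr (dur_add (tau_lay U)) (map fst rs) (St 0),
     foldr (dur_add (tau_mod U)) (map (\<lambda>r. fst (snd r)) rs) (St 0),
     sum_list (map (\<lambda>r. fst (snd (snd r))) rs),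
     sum_list (map (\<lambda>r. fst (snd (snd (snd r)))) rs),
     sum_list (map (\<lambda>r. fst (snd (snd (snd (snd r))))) rs),
     sum_list (map (\<lambda>r. snd (snd (snd (snd (snd r))))) rs))"
proof (induction rs)
  case Nil
  then show ?case
    by (simp add: resource_monoid_def DirProd_def dur_monoid_def additive_monoid_def)
next
  case (Cons r rs)
  then show ?case
    by (cases r) (simp add: resource_monoid_def DirProd_def dur_monoid_def additive_monoid_def)
qed

text \<open>Arcs are pairs of nodes, so there are no parallel arcs to choose from. This recovers a
  path from its vertex list, which is what \<open>corresponding_path\<close> prescribes.\<close>

lemma pcas_eq_zip:
  "pcas u P v \<Longrightarrow> pawalk_verts u P = u # ns \<Longrightarrow> P = zip (u # ns) ns"
proof (induction P arbitrary: u ns)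
  case (Cons e P)
  obtain ns' where ns': "pawalk_verts (snd e) P = snd e # ns'"
    by (cases P) (use Cons.prems in auto)
  moreover have "P = zip (snd e # ns') ns'"
    using Cons.IH[OF _ ns'] Cons.prems(1) by (cases e) auto
  ultimately show ?case using Cons.prems by (cases e) auto
qed simp

context
  fixes U :: "'a unit_data" and p :: "'a plan"
  assumes plan: "production_plan U p"
begin

text \<open>Index \<open>length p\<close> stands for the final arc, which starts at the horizon and has duration 0.\<close>

definition step_time :: "nat \<Rightarrow> nat" where
  "step_time i = (if i < length p then time_at p i else horizon U)"

definition step_duration :: "nat \<Rightarrow> nat" where
  "step_duration i = (if i < length p then duration (trans_at p i) else 0)"

lemma step_time_0: "step_time 0 = 1"
  using plan by (simp add: step_time_def production_plan_def)

text \<open>Valid at every index: before the last triple by chaining, at the last triple because the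
  plan ends at the horizon, and beyond it because the time is frozen and the duration is 0.\<close>

lemma step_time_Suc: "step_time (Suc i) = step_time i + step_duration i"
proof -
  consider "Suc i < length p" | "Suc i = length p" | "length p \<le> i" by linarith
  then show ?thesis
  proof cases
    case 2
    then have "i = length p - 1" "i < length p" by auto
    then show ?thesis using plan 2
      by (simp add: step_time_def step_duration_def production_plan_def)
  qed (use plan in \<open>auto simp: step_time_def step_duration_def production_plan_def\<close>)
qed

lemma step_time_mono: "i \<le> j \<Longrightarrow> step_time i \<le> step_time j"
  by (rule lift_Suc_mono_le[of step_time]) (simp add: step_time_Suc)

lemmas plan_product_feasible_iff =
  dur_product_feasible_iff[where t = step_time and d = step_duration, OF step_time_Suc]

text \<open>An arc between states determines its transition: the nodes give the two levels, and
  their time difference gives back the duration.\<close>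

lemma path_resources:
  assumes "corresponding_path U p P"
  shows "map (arc_resource U) P =
    (Ch 0 (tau_lay U - tau_init U), Ch 0 0, 0, 0, 0, 0) #
    map (\<lambda>i. transition_resource U (time_at p i) (trans_at p i)) [0..<length p] @
    [(St 0, Ch 0 0, 0, 0, 0, 0)]"
    (is "_ = ?first # map ?trans _ @ [?final]")
proof -
  define k where "k = length p"
  have k: "k > 0" using plan by (simp add: k_def production_plan_def)
  \<comment> \<open>Index \<open>k\<close> is the state reached at the horizon, so that every
    transition arc, the last included, has the form \<open>(v i, v (Suc i))\<close>.\<close>
  define v where "v i = (if i < k then State (level_at p i) (time_at p i)
      else State (s_final (trans_at p (k - 1))) (horizon U))" for i
  define ns where "ns = map v [0..<Suc k] @ [Destination]"
  have "map (\<lambda>(s, t, \<alpha>). State s t) p = map v [0..<k]"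
    by (rule nth_equalityI)
      (auto simp: k_def v_def level_at_def time_at_def split: prod.splits)
  then have nodes: "plan_nodes U p = Origin # ns"
    by (simp add: plan_nodes_def ns_def k_def v_def)
  have P: "P = zip (Origin # ns) ns"
    using assms nodes
    by (auto simp: corresponding_path_def pre_digraph.apath_def pre_digraph.awalk_def
        cas_with_proj_eq awalk_verts_with_proj_eq intro: pcas_eq_zip)
  have len: "length ns = k + 2" by (simp add: ns_def)
  have arc: "arc_resource U (v i, v (Suc i)) = ?trans i" if "i < k" for i
  proof -
    have last: "length p - Suc 0 = i" if "\<not> Suc i < length p"
      using that \<open>i < k\<close> by (simp add: k_def)
    have lev: "v i = State (level_at p i) (step_time i)"
      "v (Suc i) = State (s_final (trans_at p i)) (step_time (Suc i))"
      using that plan last by (auto simp: v_def step_time_def production_plan_def k_def)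
    have "trans_at p i = (level_at p i, s_final (trans_at p i), duration (trans_at p i))"
      using that plan by (auto simp: production_plan_def k_def s_init_def s_final_def
          duration_def prod_eq_iff)
    then show ?thesis using that
      by (simp add: lev step_time_Suc k_def) (simp add: step_time_def step_duration_def)
  qed
  show ?thesis
  proof (rule nth_equalityI)
    fix i assume "i < length (map (arc_resource U) P)"
    then have "i < k + 2" by (simp add: P len)
    \<comment> \<open>The initial arc shifts positions by one: transition \<open>m\<close> sits at
      position \<open>Suc m\<close>, the final arc at \<open>Suc k\<close>.\<close>
    then consider "i = 0" | m where "i = Suc m" "m < k" | "i = Suc k"
      by (cases i) (auto, metis less_antisym)
    then show "map (arc_resource U) P ! i = (?first # map ?trans [0..<length p] @ [?final]) ! i"
    proof cases
      case 1
      then show ?thesis by (simp add: P len ns_def del: upt_Suc)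
    next
      case (2 m)
      then have "P ! i = (v m, v (Suc m))"
        by (simp add: P len ns_def nth_append del: upt_Suc)
      then show ?thesis using 2 arc[of m] len by (simp add: nth_append P k_def[symmetric])
    next
      case 3
      then have "P ! i = (v k, Destination)"
        by (simp add: P len ns_def nth_append del: upt_Suc)
      then show ?thesis using 3 len by (simp add: nth_append P k_def[symmetric] v_def)
    qed
  qed (simp add: P len k_def[symmetric])
qed

section \<open>Changes of layer and mode along a plan\<close>

definition class_change :: "('a \<Rightarrow> 'b) \<Rightarrow> nat \<Rightarrow> bool" where
  "class_change f i \<longleftrightarrow> f (s_init (trans_at p i)) \<noteq> f (s_final (trans_at p i))"

text \<open>Consecutive transitions share a level, so the final class can alter only at a transition
  that is itself a change.\<close>

lemma next_change_iff:
  "next_change f p i j \<longleftrightarrow> j < length p \<and> next_after (class_change f) (Suc i) j"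
proof -
  let ?g = "\<lambda>m. f (s_final (trans_at p m))"
  have change: "class_change f (Suc m) \<longleftrightarrow> ?g (Suc m) \<noteq> ?g m" if "Suc m < length p" for m
    using plan that by (auto simp: class_change_def production_plan_def)
  show ?thesis
  proof
    assume nc: "next_change f p i j"
    then have bounds: "i < j" "j < length p" and last: "?g j \<noteq> ?g i"
      by (simp_all add: next_change_def)
    have inner: "?g m = ?g i" if "i \<le> m" "m < j" for m
      using that nc by (cases "m = i") (simp_all add: next_change_def)
    \<comment> \<open>Step \<open>m\<close> starts in the class in which step \<open>i\<close>
      ended, so it is a change iff it leaves that class; by minimality this happens only at
      \<open>j\<close>.\<close>
    have "class_change f m \<longleftrightarrow> m = j" if "Suc i \<le> m" "m \<le> j" for m
    proof -
      obtain n where n: "m = Suc n" "i \<le> n" using \<open>Suc i \<le> m\<close> by (cases m) auto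
      then have "class_change f m \<longleftrightarrow> ?g m \<noteq> ?g i"
        using change[of n] inner[of n] that bounds by simp
      then show ?thesis using inner[of m] last that n by (cases "m = j") auto
    qed
    then show "j < length p \<and> next_after (class_change f) (Suc i) j"
      using bounds by (simp add: next_after_def)
  next
    assume na: "j < length p \<and> next_after (class_change f) (Suc i) j"
    then have bounds: "Suc i \<le> j" "j < length p" and cj: "class_change f j"
      and none: "\<And>m. Suc i \<le> m \<Longrightarrow> m < j \<Longrightarrow> \<not> class_change f m"
      by (simp_all add: next_after_def)
    have inner: "i \<le> m \<Longrightarrow> m < j \<Longrightarrow> ?g m = ?g i" for m
    proof (induction m rule: dec_induct)
      case (step m)
      then show ?case using bounds none[of "Suc m"] change[of m] by simp
    qed simp
    obtain n where n: "j = Suc n" "i \<le> n" using bounds(1) by (cases j) auto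
    then have "?g j \<noteq> ?g i" using cj bounds change[of n] inner[of n] by simp
    then show "next_change f p i j"
      unfolding next_change_def using bounds inner by (meson Suc_le_lessD less_imp_le)
  qed
qed

text \<open>The final arc carries \<open>St 0\<close> here, so index \<open>length p\<close> is
  unmarked. In the test of the initial arc \<open>tau_lay U\<close> cancels, which leaves the bound
  by \<open>tau_init U\<close>.\<close>

lemma layer_product_feasible_iff:
  "dur_add (tau_lay U) (Ch 0 (tau_lay U - tau_init U))
     (foldr (dur_add (tau_lay U))
       (map (dur_item (\<lambda>i. i < length p \<and> class_change f i) step_duration) [0..<Suc (length p)])
       (St 0)) \<noteq> Infeasible \<longleftrightarrow>
   (\<forall>i j. Suc i < length p \<and> class_change f i \<and> next_change f p i j \<longrightarrow>
      time_at p (Suc i) + tau_lay U \<le> time_at p j) \<and>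
   (\<forall>i < length p. class_change f i \<longrightarrow> 1 + tau_init U \<le> real (time_at p i))"
proof -
  let ?c = "\<lambda>i. i < length p \<and> class_change f i"
  \<comment> \<open>A marked \<open>j\<close> lies below \<open>length p\<close>, which forces
    \<open>Suc i < length p\<close>.\<close>
  have pair: "j < Suc (length p) \<and> ?c i \<and> next_after ?c (Suc i) j \<longleftrightarrow>
      Suc i < length p \<and> class_change f i \<and> next_change f p i j" for i j
    unfolding next_change_iff by (auto simp: next_after_def)
  have time: "real (step_time (Suc i)) + real (tau_lay U) \<le> real (step_time j) \<longleftrightarrow>
      time_at p (Suc i) + tau_lay U \<le> time_at p j"
    if "Suc i < length p" "next_change f p i j" for i j
    using that by (simp add: step_time_def next_change_def flip: of_nat_add)
  show ?thesis
    unfolding plan_product_feasible_iff pair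
  proof (rule arg_cong2[of _ _ _ _ "(\<and>)"])
    show "(\<forall>i j. Suc i < length p \<and> class_change f i \<and> next_change f p i j \<longrightarrow>
        real (step_time (Suc i)) + real (tau_lay U) \<le> real (step_time j)) \<longleftrightarrow>
      (\<forall>i j. Suc i < length p \<and> class_change f i \<and> next_change f p i j \<longrightarrow>
        time_at p (Suc i) + tau_lay U \<le> time_at p j)"
      using time by blast
  next
    show "(\<forall>j<Suc (length p). j < length p \<and> class_change f j \<longrightarrow>
        real (step_time 0) + real (tau_lay U) \<le> real (tau_lay U) - tau_init U + real (step_time j)) \<longleftrightarrow>
      (\<forall>i<length p. class_change f i \<longrightarrow> 1 + tau_init U \<le> real (time_at p i))"
      unfolding step_time_0 by (auto simp: step_time_def algebra_simps)
  qed
qed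

text \<open>The implication marks index \<open>length p\<close> as a change, since the final arc
  carries \<open>Ch 0 0\<close>. The horizon thus closes the last mode, just as the initial arc
  opens the first.\<close>

lemma mode_product_feasible_iff:
  "dur_add (tau_mod U) (Ch 0 0)
     (foldr (dur_add (tau_mod U))
       (map (dur_item (\<lambda>i. i < length p \<longrightarrow> class_change f i) step_duration) [0..<Suc (length p)])
       (St 0)) \<noteq> Infeasible \<longleftrightarrow>
   (\<forall>i j. Suc i < length p \<and> class_change f i \<and> next_change f p i j \<longrightarrow>
      time_at p (Suc i) + tau_mod U \<le> time_at p j) \<and>
   (\<forall>i < length p. class_change f i \<longrightarrow>
      1 + tau_mod U \<le> time_at p i \<and>
      time_at p i + duration (trans_at p i) + tau_mod U \<le> horizon U) \<and>
   1 + tau_mod U \<le> horizon U"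
    (is "_ \<longleftrightarrow> ?R")
proof -
  let ?k = "length p"
  let ?c = "\<lambda>i. i < ?k \<longrightarrow> class_change f i"
  \<comment> \<open>\<open>?A\<close> and \<open>?B\<close> are the two halves of the product
    criterion, over the naturals instead of the reals.\<close>
  let ?A = "\<forall>i j. j < Suc ?k \<and> ?c i \<and> next_after ?c (Suc i) j \<longrightarrow>
      step_time (Suc i) + tau_mod U \<le> step_time j"
  let ?B = "\<forall>j<Suc ?k. ?c j \<longrightarrow> 1 + tau_mod U \<le> step_time j"
  have suc: "step_time (Suc i) = time_at p i + duration (trans_at p i)" if "i < ?k" for i
    using that by (simp add: step_time_Suc) (simp add: step_time_def step_duration_def)
  have hor: "step_time ?k = horizon U" by (simp add: step_time_def)
  have next_inner: "next_after ?c (Suc i) j \<longleftrightarrow> next_change f p i j" if "j < ?k" for i j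
    using that by (auto simp: next_change_iff next_after_def)
  have "?A \<and> ?B \<longleftrightarrow> ?R"
  proof
    assume AB: "?A \<and> ?B"
    have "time_at p (Suc i) + tau_mod U \<le> time_at p j"
      if "Suc i < ?k" "class_change f i" "next_change f p i j" for i j
    proof -
      have "j < ?k" using that by (simp add: next_change_def)
      then have "step_time (Suc i) + tau_mod U \<le> step_time j"
        using AB that next_inner by auto
      then show ?thesis using that \<open>j < ?k\<close> by (simp add: step_time_def)
    qed
    moreover have "time_at p i + duration (trans_at p i) + tau_mod U \<le> horizon U"
      if "i < ?k" "class_change f i" for i
    proof -
      \<comment> \<open>Such a \<open>j\<close> exists because \<open>length p\<close> is marked.
        Its time is at most the horizon, so the bound at \<open>j\<close> carries over to the
        horizon.\<close>
      obtain j where j: "next_after ?c (Suc i) j" "j \<le> ?k"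
        by (rule next_after_exists[of ?c ?k "Suc i"]) (use \<open>i < ?k\<close> in simp_all)
      then have "step_time (Suc i) + tau_mod U \<le> step_time j" using AB that by auto
      then show ?thesis using step_time_mono[OF j(2)] suc[OF that(1)] hor by linarith
    qed
    moreover have "1 + tau_mod U \<le> time_at p i" if "i < ?k" "class_change f i" for i
    proof -
      have "1 + tau_mod U \<le> step_time i" using AB that by simp
      then show ?thesis using that by (simp add: step_time_def)
    qed
    \<comment> \<open>Instance of \<open>?B\<close> at index \<open>length p\<close>, whose time is
      the horizon.\<close>
    moreover have "1 + tau_mod U \<le> horizon U" using AB hor by fastforce
    ultimately show ?R by blast
  next
    assume R: ?R
    have "step_time (Suc i) + tau_mod U \<le> step_time j"
      if "j < Suc ?k" "?c i" "next_after ?c (Suc i) j" for i j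
    proof -
      \<comment> \<open>Indices from \<open>length p\<close> on satisfy \<open>?c\<close> vacuously,
        but none of them has a successor \<open>j\<close> in range.\<close>
      have i: "i < ?k" "class_change f i" "Suc i \<le> j" using that by (auto simp: next_after_def)
      show ?thesis
      proof (cases "j = ?k")
        case True
        then show ?thesis using R i suc hor by auto
      next
        case False
        then have "j < ?k" using that by simp
        then show ?thesis using R i that next_inner by (auto simp: step_time_def)
      qed
    qed
    moreover have ?B using R by (auto simp: less_Suc_eq step_time_def)
    ultimately show "?A \<and> ?B" by blast
  qed
  then show ?thesis
    unfolding plan_product_feasible_iff step_time_0
    by (simp flip: of_nat_add of_nat_Suc)
qed

section \<open>Components of the path resource and the value of \<open>rho\<close>\<close>

lemma layer_resource_eq:
  assumes "corresponding_path U p P"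
  shows "fst (path_resource U P) = dur_add (tau_lay U) (Ch 0 (tau_lay U - tau_init U))
     (foldr (dur_add (tau_lay U))
       (map (dur_item (\<lambda>i. i < length p \<and> class_change (layer U) i) step_duration)
         [0..<Suc (length p)]) (St 0))"
  unfolding path_resource_def path_resources[OF assms] resource_product_components
  \<comment> \<open>Entry \<open>length p\<close> is unmarked and has duration 0, which gives the
    \<open>St 0\<close> of the final arc.\<close>
  by (simp add: comp_def dur_item_def transition_resource_def class_change_def
      layer_change_def step_duration_def[of "length p"])
    (intro arg_cong2[where f = "dur_add _"] foldr_cong map_cong refl;
      simp add: dur_item_def step_duration_def)

lemma mode_resource_eq:
  assumes "corresponding_path U p P"
  shows "fst (snd (path_resource U P)) = dur_add (tau_mod U) (Ch 0 0)
     (foldr (dur_add (tau_mod U))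
       (map (dur_item (\<lambda>i. i < length p \<longrightarrow> class_change (mode U) i) step_duration)
         [0..<Suc (length p)]) (St 0))"
  unfolding path_resource_def path_resources[OF assms] resource_product_components
  \<comment> \<open>Here entry \<open>length p\<close> is marked, which gives the
    \<open>Ch 0 0\<close> of the final arc.\<close>
  by (simp add: comp_def dur_item_def transition_resource_def class_change_def
      mode_change_def step_duration_def[of "length p"])
    (intro arg_cong2[where f = "dur_add _"] foldr_cong map_cong refl;
      simp add: dur_item_def step_duration_def)

lemma additive_resources_eq:
  assumes "corresponding_path U p P"
  shows "snd (snd (path_resource U P)) =
    ((\<Sum>i < length p. indicator (startups U) (trans_at p i)),
     (\<Sum>i < length p. indicator (layer_count_set U) (trans_at p i)),
     (\<Sum>i < length p. indicator (deeps U) (trans_at p i)),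
     cost U p)"
  unfolding path_resource_def path_resources[OF assms] resource_product_components
  by (simp add: comp_def transition_resource_def cost_def atLeast0LessThan
      flip: sum_set_upt_conv_sum_list_nat)

end

text \<open>Each entry of the maximum is 0 or 1, so the maximum vanishes exactly when all entries
  do.\<close>

lemma rho_eq_0_iff:
  "rho U (ql, qm, ns, nl, nd, c) = 0 \<longleftrightarrow>
     ql \<noteq> Infeasible \<and> qm \<noteq> Infeasible \<and>
     ns \<le> max_startups U \<and> nl \<le> max_layer_changes U \<and> nd \<le> max_deeps U"
  by (auto simp: indicator_def max_def)

text \<open>The initial arc, and for modes also the final one, is tested like a change. A vanishing
  \<open>rho\<close> therefore says more than \<open>feasible\<close> alone, and
  \<open>boundary_conditions\<close> collects the excess.\<close>

theorem proposition9:
  fixes U :: "'a unit_data" and p :: "'a plan" and P :: "('a node \<times> 'a node) list"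
  assumes "valid_unit U"
    and "production_plan U p"
    and "corresponding_path U p P"
  shows "(feasible U p \<and> boundary_conditions U p \<longleftrightarrow> rho U (path_resource U P) = 0) \<and>
         cost U p = res_cost (path_resource U P)"
proof -
  note plan = assms(2) and path = assms(3)
  obtain ql qm rest where q: "path_resource U P = (ql, qm, rest)"
    by (cases "path_resource U P") auto
  have rest: "rest =
    ((\<Sum>i < length p. indicator (startups U) (trans_at p i)),
     (\<Sum>i < length p. indicator (layer_count_set U) (trans_at p i)),
     (\<Sum>i < length p. indicator (deeps U) (trans_at p i)),
     cost U p)"
    using additive_resources_eq[OF plan path] q by simp
  have change: "class_change p (layer U) i \<longleftrightarrow> layer_change U (trans_at p i)"
    "class_change p (mode U) i \<longleftrightarrow> mode_change U (trans_at p i)" for i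
    by (simp_all add: class_change_def[OF plan] layer_change_def mode_change_def)
  have ql: "ql \<noteq> Infeasible \<longleftrightarrow>
   (\<forall>i j. Suc i < length p \<and> layer_change U (trans_at p i) \<and> next_change (layer U) p i j \<longrightarrow>
      time_at p (Suc i) + tau_lay U \<le> time_at p j) \<and>
   (\<forall>i < length p. layer_change U (trans_at p i) \<longrightarrow> 1 + tau_init U \<le> real (time_at p i))"
    using layer_resource_eq[OF plan path] layer_product_feasible_iff[OF plan, of "layer U"] q
    by (simp add: change)
  have qm: "qm \<noteq> Infeasible \<longleftrightarrow>
   (\<forall>i j. Suc i < length p \<and> mode_change U (trans_at p i) \<and> next_change (mode U) p i j \<longrightarrow>
      time_at p (Suc i) + tau_mod U \<le> time_at p j) \<and>
   (\<forall>i < length p. mode_change U (trans_at p i) \<longrightarrow>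
      1 + tau_mod U \<le> time_at p i \<and>
      time_at p i + duration (trans_at p i) + tau_mod U \<le> horizon U) \<and>
   1 + tau_mod U \<le> horizon U"
    using mode_resource_eq[OF plan path] mode_product_feasible_iff[OF plan, of "mode U"] q
    by (simp add: change)
  \<comment> \<open>Regrouping: the layer and mode components each yield one spacing condition of
    \<open>feasible\<close> and their share of \<open>boundary_conditions\<close>; the counts yield
    the rest.\<close>
  have "rho U (path_resource U P) = 0 \<longleftrightarrow> feasible U p \<and> boundary_conditions U p"
    unfolding q rest rho_eq_0_iff ql qm feasible_def boundary_conditions_def by blast
  then show ?thesis by (simp add: q rest)
qed

end
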